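(* Let $d$ be a positive integer. For positive integers $n,p$ let $\mu_{n,p}$ and $\mu_p$ be probability measures on $\mathbb{R}^d$ with characteristic functions $\varphi_{n,p}$ and $\varphi_p$, respectively. Assume that the collection $\{\mu_p\}$ is relatively compact with respect to the total variation metric. Then $\mu_{n,p}\Longrightarrow\mu_p$ uniformly-over-$p$ if and only if for every $\mathbf{t}\in\mathbb{R}^d$, $$\lim_{n\to\infty}\sup_p|\varphi_{n,p}(\mathbf{t})-\varphi_p(\mathbf{t})|=0.$$
   Context: The indices $n$ and $p$ range over the positive integers. By definition, $\mu_{n,p}\Longrightarrow\mu_p$ uniformly-over-$p$ means that for every bounded continuous function $f:\mathbb{R}^d\to\mathbb{R}$, $\lim_{n\to\infty}\sup_p\left|\int f\,\mathrm{d}\mu_{n,p}-\int f\,\mathrm{d}\mu_p\right|=0$. Relative compactness of $\{\mu_p\}$ with respect to the total variation metric means: every sequence $\{\mu_{p_n}\}$ in $\{\mu_p\}$ has a subsequence $\{\mu_{p_{n_k}}\}$ such that $\sup_{C}|\mu_{p_{n_k}}(C)-\nu(C)|\to 0$ as $k\to\infty$ (supremum over Borel sets $C\subset\mathbb{R}^d$) for some probability measure $\nu$ on $\mathbb{R}^d$ ($\nu$ need not belong to $\{\mu_p\}$). *)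

theory Defs
  imports "HOL-Probability.Probability"
begin

definition borel_prob :: "'a::topological_space measure \<Rightarrow> bool" where
  "borel_prob M \<longleftrightarrow> prob_space M \<and> sets M = sets borel"

text \<open>The library's \<open>char\<close> is restricted to measures on the real line.\<close>

definition char_fun :: "'a::euclidean_space measure \<Rightarrow> 'a \<Rightarrow> complex" where
  "char_fun M t = (CLINT x|M. iexp (t \<bullet> x))"

text \<open>All suprema below are taken in the reals. For probability measures they range over nonempty
  bounded sets, so they are genuine least upper bounds. The indices \<open>n\<close> and \<open>p\<close> are positive
  integers; the value at \<open>n = 0\<close> is irrelevant to the limits.\<close>

definition tv_dist :: "'a::topological_space measure \<Rightarrow> 'a measure \<Rightarrow> real" where
  "tv_dist M N = (SUP C\<in>sets borel. \<bar>measure M C - measure N C\<bar>)"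

text \<open>The limit \<open>\<nu>\<close> need not belong to \<open>A\<close>.\<close>

definition tv_relatively_compact :: "'a::topological_space measure set \<Rightarrow> bool" where
  "tv_relatively_compact A \<longleftrightarrow>
     (\<forall>\<xi> :: nat \<Rightarrow> 'a measure. (\<forall>n. \<xi> n \<in> A) \<longrightarrow>
        (\<exists>k \<nu>. strict_mono k \<and> borel_prob \<nu> \<and> (\<lambda>j. tv_dist (\<xi> (k j)) \<nu>) \<longlonglongrightarrow> 0))"

definition weak_conv_uniformly ::
    "(nat \<Rightarrow> nat \<Rightarrow> 'a::topological_space measure) \<Rightarrow> (nat \<Rightarrow> 'a measure) \<Rightarrow> bool" where
  "weak_conv_uniformly \<mu>n \<mu> \<longleftrightarrow>
     (\<forall>f :: 'a \<Rightarrow> real. continuous_on UNIV f \<longrightarrow> bounded (range f) \<longrightarrow>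
        (\<lambda>n. SUP p\<in>{1..}. \<bar>(LINT x|\<mu>n n p. f x) - (LINT x|\<mu> p. f x)\<bar>) \<longlonglongrightarrow> 0)"

end

theory Submission
  imports Defs
begin

text \<open>
  A supremum over \<open>p\<close> tends to zero exactly when every choice of indices \<open>p = q n\<close> gives a sequence
  tending to zero. This turns both sides of the equivalence into statements about pairs of
  sequences \<open>M n = \<mu>n (Suc n) (q n)\<close> and \<open>N n = \<mu> (q n)\<close> of probability measures, and the theorem
  becomes a version of the Levy continuity theorem in which the limit measure is replaced by a
  moving target: if the sequence \<open>N\<close> is tight and the difference of the characteristic functions
  of \<open>M n\<close> and \<open>N n\<close> tends to zero pointwise, then so does the difference of the integrals of every
  bounded continuous function (\<open>tendsto_integral_diff_of_char_fun\<close>). Tightness is all that relative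
  compactness in total variation is used for (\<open>tv_relatively_compact_imp_tight\<close>). The converse
  direction only tests weak convergence on cosines and sines.

  The continuity theorem is proved by approximation. Convergence of the differences passes
  from characteristic functions to all trigonometric polynomials by linearity. On a large ball, a
  bounded continuous \<open>f\<close> is uniformly close to a trigonometric polynomial by the Stone-Weierstrass
  theorem. Off the ball, one needs a bound on that polynomial which does not depend on the radius,
  and small mass for both measures. The bound comes from composing with a polynomial that
  approximates truncation to the range of \<open>f\<close> (\<open>trig_polynomial_approx\<close>), which keeps the function a
  trigonometric polynomial.

  The mass of \<open>N n\<close> off the ball is small by tightness. Trigonometric polynomials cannot detect mass
  that escapes to infinity, because they are almost periodic; to transfer tightness to \<open>M n\<close>, one needs
  infinite mixtures of characters. Averaging characters over a normal law gives Gaussian functions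
  (\<open>integral_gaussian_eq_char_fun\<close>), and dominated convergence shows that their integrals under
  \<open>M n\<close> and \<open>N n\<close> become equal as well. A Gaussian that is nearly constant on a large ball and
  visibly smaller than one far out then bounds the tails of \<open>M n\<close> (\<open>eventually_tail_le\<close>).
\<close>

section \<open>Suprema and sequences of indices\<close>

text \<open>For the nontrivial direction, \<open>q n\<close> is chosen so that \<open>a n (q n)\<close> misses the supremum by less
  than \<open>1 / (n + 1)\<close>.\<close>

lemma tendsto_SUP_zero_iff_choice:
  fixes a :: "nat \<Rightarrow> 'i \<Rightarrow> real"
  assumes "I \<noteq> {}" and bounds: "\<And>n p. p \<in> I \<Longrightarrow> 0 \<le> a n p" "\<And>n p. p \<in> I \<Longrightarrow> a n p \<le> C"
  shows "(\<lambda>n. SUP p\<in>I. a n p) \<longlonglongrightarrow> 0 \<longleftrightarrow> (\<forall>q. (\<forall>n. q n \<in> I) \<longrightarrow> (\<lambda>n. a n (q n)) \<longlonglongrightarrow> 0)"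
proof (intro iffI allI impI)
  have bdd: "bdd_above (a n ` I)" for n
    using bounds by (auto intro!: bdd_aboveI[of _ C])
  {
    fix q :: "nat \<Rightarrow> 'i" assume lim: "(\<lambda>n. SUP p\<in>I. a n p) \<longlonglongrightarrow> 0" and q: "\<forall>n. q n \<in> I"
    show "(\<lambda>n. a n (q n)) \<longlonglongrightarrow> 0"
    proof (rule tendsto_sandwich[OF _ _ tendsto_const lim])
      show "\<forall>\<^sub>F n in sequentially. 0 \<le> a n (q n)"
        using q bounds by simp
      show "\<forall>\<^sub>F n in sequentially. a n (q n) \<le> (SUP p\<in>I. a n p)"
        using q bdd by (intro always_eventually allI cSUP_upper) auto
    qed
  next
    assume all: "\<forall>q. (\<forall>n. q n \<in> I) \<longrightarrow> (\<lambda>n. a n (q n)) \<longlonglongrightarrow> 0"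
    have "\<exists>p\<in>I. (SUP p\<in>I. a n p) - inverse (real (Suc n)) < a n p" for n
      using less_cSUP_iff[OF \<open>I \<noteq> {}\<close> bdd, of "(SUP p\<in>I. a n p) - inverse (real (Suc n))" n] by simp
    then obtain q where q: "\<And>n. q n \<in> I"
      "\<And>n. (SUP p\<in>I. a n p) - inverse (real (Suc n)) < a n (q n)"
      by metis
    have "(\<lambda>n. a n (q n) + inverse (real (Suc n))) \<longlonglongrightarrow> 0 + 0"
      using all q(1) by (intro tendsto_add LIMSEQ_inverse_real_of_nat) auto
    then have lim: "(\<lambda>n. a n (q n) + inverse (real (Suc n))) \<longlonglongrightarrow> 0"
      by simp
    show "(\<lambda>n. SUP p\<in>I. a n p) \<longlonglongrightarrow> 0"
    proof (rule tendsto_sandwich[OF _ _ tendsto_const lim])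
      show "\<forall>\<^sub>F n in sequentially. 0 \<le> (SUP p\<in>I. a n p)"
        using q(1) bounds bdd by (intro always_eventually allI) (meson cSUP_upper2)
      show "\<forall>\<^sub>F n in sequentially. (SUP p\<in>I. a n p) \<le> a n (q n) + inverse (real (Suc n))"
        using q(2) by (intro always_eventually allI) (simp add: less_imp_le diff_less_eq)
    qed
  }
qed

section \<open>Bounded continuous functions and characteristic functions\<close>

lemma borel_prob_imp_prob_space: "borel_prob M \<Longrightarrow> prob_space M"
  by (simp add: borel_prob_def)

lemma borel_prob_imp_sets: "borel_prob M \<Longrightarrow> sets M = sets borel"
  by (simp add: borel_prob_def)

lemma borel_prob_imp_space: "borel_prob M \<Longrightarrow> space M = UNIV"
  using borel_prob_imp_sets[THEN sets_eq_imp_space_eq] by simp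

lemma borel_prob_integrable:
  fixes f :: "'a::topological_space \<Rightarrow> 'b::{banach, second_countable_topology}"
  assumes M: "borel_prob M" and "continuous_on UNIV f" and "\<And>x. norm (f x) \<le> B"
  shows "integrable M f"
proof -
  interpret prob_space M using M by (rule borel_prob_imp_prob_space)
  show ?thesis
    using assms(3) borel_measurable_continuous_onI[OF assms(2)]
    by (intro integrable_const_bound[of _ B])
      (auto cong: measurable_cong_sets simp: borel_prob_imp_sets[OF M])
qed

lemma abs_integral_le_bound:
  fixes f :: "'a::topological_space \<Rightarrow> real"
  assumes M: "borel_prob M" and "continuous_on UNIV f" and "\<And>x. \<bar>f x\<bar> \<le> B"
  shows "\<bar>LINT x|M. f x\<bar> \<le> B"
proof -
  interpret prob_space M using M by (rule borel_prob_imp_prob_space)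
  have "integrable M f"
    using assms by (intro borel_prob_integrable) auto
  moreover have "- B \<le> f x" "f x \<le> B" for x
    using assms(3)[of x] by auto
  ultimately show ?thesis
    using integral_ge_const[of f "-B"] integral_le_const[of f B] by (auto simp: abs_le_iff)
qed

lemma char_fun_eq_Complex:
  fixes M :: "'a::euclidean_space measure"
  assumes M: "borel_prob M"
  shows "char_fun M t = Complex (LINT x|M. cos (t \<bullet> x)) (LINT x|M. sin (t \<bullet> x))"
proof -
  have "integrable M (\<lambda>x. iexp (t \<bullet> x))"
    by (rule borel_prob_integrable[OF M, of _ 1]) (auto intro!: continuous_intros)
  then have "Re (char_fun M t) = (LINT x|M. Re (iexp (t \<bullet> x)))"
    "Im (char_fun M t) = (LINT x|M. Im (iexp (t \<bullet> x)))"
    by (simp_all only: char_fun_def integral_Re integral_Im)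
  then show ?thesis
    by (simp add: complex_eq_iff Re_exp Im_exp)
qed

lemma cmod_char_fun_le_1:
  fixes M :: "'a::euclidean_space measure"
  assumes M: "borel_prob M"
  shows "cmod (char_fun M t) \<le> 1"
proof -
  interpret prob_space M using M by (rule borel_prob_imp_prob_space)
  have "cmod (char_fun M t) \<le> (LINT x|M. cmod (iexp (t \<bullet> x)))"
    unfolding char_fun_def by (rule integral_norm_bound)
  also have "\<dots> = 1"
    by (simp add: prob_space)
  finally show ?thesis .
qed

lemma tendsto_char_fun_diff_iff:
  fixes M N :: "nat \<Rightarrow> 'a::euclidean_space measure"
  assumes "\<And>n. borel_prob (M n)" "\<And>n. borel_prob (N n)"
  shows "(\<lambda>n. char_fun (M n) t - char_fun (N n) t) \<longlonglongrightarrow> 0 \<longleftrightarrow>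
    (\<lambda>n. (LINT x|M n. cos (t \<bullet> x)) - (LINT x|N n. cos (t \<bullet> x))) \<longlonglongrightarrow> 0 \<and>
    (\<lambda>n. (LINT x|M n. sin (t \<bullet> x)) - (LINT x|N n. sin (t \<bullet> x))) \<longlonglongrightarrow> 0"
  by (simp add: tendsto_complex_iff char_fun_eq_Complex assms)

section \<open>Trigonometric polynomials\<close>

text \<open>Only linear combinations are generated, not products: the generating rules are then exactly
  the steps by which convergence of integrals passes from characters to their span. Closure under
  products is a consequence of the product formulas for sine and cosine.\<close>

inductive trig_polynomial :: "('a::euclidean_space \<Rightarrow> real) \<Rightarrow> bool" where
  cos: "trig_polynomial (\<lambda>x. cos (t \<bullet> x))"
| sin: "trig_polynomial (\<lambda>x. sin (t \<bullet> x))"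
| scale: "trig_polynomial f \<Longrightarrow> trig_polynomial (\<lambda>x. c * f x)"
| add: "trig_polynomial f \<Longrightarrow> trig_polynomial g \<Longrightarrow> trig_polynomial (\<lambda>x. f x + g x)"

lemma trig_polynomial_const: "trig_polynomial (\<lambda>x. c)"
  using trig_polynomial.scale[OF trig_polynomial.cos[of 0], of c] by simp

lemma trig_polynomial_continuous: "trig_polynomial f \<Longrightarrow> continuous_on S f"
  by (induction rule: trig_polynomial.induct) (auto intro!: continuous_intros)

lemma trig_polynomial_bounded: "trig_polynomial f \<Longrightarrow> \<exists>C. \<forall>x. \<bar>f x\<bar> \<le> C"
proof (induction rule: trig_polynomial.induct)
  case (scale f c)
  then obtain C where "\<And>x. \<bar>f x\<bar> \<le> C" by blast
  then have "\<bar>c * f x\<bar> \<le> \<bar>c\<bar> * C" for x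
    by (simp add: abs_mult mult_left_mono)
  then show ?case by blast
next
  case (add f g)
  then obtain C D where "\<And>x. \<bar>f x\<bar> \<le> C" "\<And>x. \<bar>g x\<bar> \<le> D" by blast
  then have "\<bar>f x + g x\<bar> \<le> C + D" for x
    by (meson abs_triangle_ineq add_mono order_trans)
  then show ?case by blast
qed (auto intro!: exI[of _ 1])

lemma trig_polynomial_mult_cos_sin:
  assumes "trig_polynomial g"
  shows "trig_polynomial (\<lambda>x. cos (t \<bullet> x) * g x)" "trig_polynomial (\<lambda>x. sin (t \<bullet> x) * g x)"
  using assms
proof (induction rule: trig_polynomial.induct)
  case (cos s)
  have cos_eq: "(\<lambda>x. cos (t \<bullet> x) * cos (s \<bullet> x)) =
      (\<lambda>x. (1/2) * (cos ((t - s) \<bullet> x) + cos ((t + s) \<bullet> x)))"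
    by (simp add: cos_times_cos inner_diff_left inner_add_left)
  have sin_eq: "(\<lambda>x. sin (t \<bullet> x) * cos (s \<bullet> x)) =
      (\<lambda>x. (1/2) * (sin ((t + s) \<bullet> x) + sin ((t - s) \<bullet> x)))"
    by (simp add: sin_times_cos inner_diff_left inner_add_left)
  show
    "trig_polynomial (\<lambda>x. cos (t \<bullet> x) * cos (s \<bullet> x))"
    "trig_polynomial (\<lambda>x. sin (t \<bullet> x) * cos (s \<bullet> x))"
    unfolding cos_eq sin_eq by (intro trig_polynomial.intros)+
next
  case (sin s)
  have cos_eq: "(\<lambda>x. cos (t \<bullet> x) * sin (s \<bullet> x)) =
      (\<lambda>x. (1/2) * (sin ((t + s) \<bullet> x) + (-1) * sin ((t - s) \<bullet> x)))"
    by (simp add: cos_times_sin inner_diff_left inner_add_left)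
  have sin_eq: "(\<lambda>x. sin (t \<bullet> x) * sin (s \<bullet> x)) =
      (\<lambda>x. (1/2) * (cos ((t - s) \<bullet> x) + (-1) * cos ((t + s) \<bullet> x)))"
    by (simp add: sin_times_sin inner_diff_left inner_add_left)
  show
    "trig_polynomial (\<lambda>x. cos (t \<bullet> x) * sin (s \<bullet> x))"
    "trig_polynomial (\<lambda>x. sin (t \<bullet> x) * sin (s \<bullet> x))"
    unfolding cos_eq sin_eq by (intro trig_polynomial.intros)+
next
  case (scale g c)
  then show
    "trig_polynomial (\<lambda>x. cos (t \<bullet> x) * (c * g x))"
    "trig_polynomial (\<lambda>x. sin (t \<bullet> x) * (c * g x))"
    by (simp_all only: mult.left_commute[of _ c] trig_polynomial.scale)
next
  case (add f g)
  then show
    "trig_polynomial (\<lambda>x. cos (t \<bullet> x) * (f x + g x))"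
    "trig_polynomial (\<lambda>x. sin (t \<bullet> x) * (f x + g x))"
    by (simp_all only: distrib_left trig_polynomial.add)
qed

lemma trig_polynomial_mult:
  assumes "trig_polynomial f" "trig_polynomial g"
  shows "trig_polynomial (\<lambda>x. f x * g x)"
  using assms(1)
proof (induction rule: trig_polynomial.induct)
  case (scale f c)
  then show ?case by (simp only: mult.assoc trig_polynomial.scale)
next
  case (add f1 f2)
  then show ?case by (simp only: distrib_right trig_polynomial.add)
qed (simp_all add: trig_polynomial_mult_cos_sin assms(2))

lemma trig_polynomial_compose:
  fixes q :: "real \<Rightarrow> real"
  assumes "real_polynomial_function q" "trig_polynomial f"
  shows "trig_polynomial (\<lambda>x. q (f x))"
  using assms(1)
proof (induction rule: real_polynomial_function.induct)
  case (linear h)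
  then obtain c where "h = (\<lambda>x. x * c)"
    by (auto simp: real_bounded_linear)
  then show ?case
    using trig_polynomial.scale[OF assms(2), of c] by (simp add: mult.commute)
qed (use assms(2) in \<open>auto intro: trig_polynomial_const trig_polynomial.add trig_polynomial_mult\<close>)

text \<open>Scaling the frequency along \<open>x - y\<close> makes the two phases differ by exactly 1, which is not a
  multiple of the period, so that sine and cosine cannot both agree.\<close>

lemma trig_polynomial_separates:
  fixes x y :: "'a::euclidean_space"
  assumes "x \<noteq> y"
  shows "\<exists>f. trig_polynomial f \<and> f x \<noteq> f y"
proof (rule ccontr)
  assume neg: "\<not> ?thesis"
  define t where "t = (1 / (norm (x - y))\<^sup>2) *\<^sub>R (x - y)"
  have "t \<bullet> x - t \<bullet> y = t \<bullet> (x - y)"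
    by (rule inner_diff_right[symmetric])
  also have "\<dots> = 1"
    using assms by (simp only: t_def inner_scaleR_left dot_square_norm) simp
  finally have "t \<bullet> x - t \<bullet> y = 1" .
  moreover have "cos (t \<bullet> x) = cos (t \<bullet> y)" "sin (t \<bullet> x) = sin (t \<bullet> y)"
    using neg trig_polynomial.cos[of t] trig_polynomial.sin[of t] by blast+
  then have "cos (t \<bullet> x - t \<bullet> y) = 1"
    by (simp add: cos_diff flip: power2_eq_square)
  ultimately have "cos (1::real) = cos 0"
    by simp
  then show False
    using cos_inj_pi[of 1 0] pi_gt3 by simp
qed

text \<open>Stone-Weierstrass alone controls the approximant \<open>g\<close> only on \<open>S\<close>. But \<open>g\<close> is bounded by some
  \<open>C\<close> on the whole space, so a polynomial \<open>q\<close> that approximates truncation to \<open>[-B, B]\<close> on \<open>[-C, C]\<close>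
  repairs this: \<open>q \<circ> g\<close> is again a trigonometric polynomial, and truncation does not
  increase the distance to \<open>f\<close>. The point is that the global bound \<open>B + e\<close> is independent of \<open>S\<close>.\<close>

lemma trig_polynomial_approx:
  fixes f :: "'a::euclidean_space \<Rightarrow> real"
  assumes "compact S" "continuous_on S f" "\<And>x. x \<in> S \<Longrightarrow> \<bar>f x\<bar> \<le> B" "0 \<le> B" "0 < e"
  obtains h where "trig_polynomial h" "\<And>x. x \<in> S \<Longrightarrow> \<bar>f x - h x\<bar> \<le> e" "\<And>x. \<bar>h x\<bar> \<le> B + e"
proof -
  interpret function_ring_on "Collect trig_polynomial" S
    using assms(1) trig_polynomial_separates
    by unfold_locales (auto intro: trig_polynomial_continuous trig_polynomial_const
        trig_polynomial.add trig_polynomial_mult)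
  obtain g where g: "trig_polynomial g" "\<And>x. x \<in> S \<Longrightarrow> \<bar>f x - g x\<bar> < e / 2"
    using Stone_Weierstrass_basic[OF assms(2), of "e / 2"] \<open>0 < e\<close> by auto
  obtain C where C: "\<And>x. \<bar>g x\<bar> \<le> C"
    using trig_polynomial_bounded[OF g(1)] by blast
  define clip where "clip y = max (- B) (min B y)" for y :: real
  have "continuous_on {-C..C} clip"
    unfolding clip_def by (intro continuous_intros)
  then obtain q where q: "real_polynomial_function q" "\<And>y. y \<in> {-C..C} \<Longrightarrow> \<bar>clip y - q y\<bar> < e / 2"
    using Stone_Weierstrass_real_polynomial_function[of "{-C..C}" clip "e / 2"] \<open>0 < e\<close> by auto
  have q_g: "\<bar>clip (g x) - q (g x)\<bar> < e / 2" for x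
    using q(2)[of "g x"] C[of x] by (simp add: abs_le_iff)
  show ?thesis
  proof
    show "trig_polynomial (\<lambda>x. q (g x))"
      using q(1) g(1) by (rule trig_polynomial_compose)
    show "\<bar>f x - q (g x)\<bar> \<le> e" if "x \<in> S" for x
    proof -
      have "\<bar>f x - clip (g x)\<bar> \<le> \<bar>f x - g x\<bar>"
        using assms(3)[OF that] \<open>0 \<le> B\<close> unfolding clip_def by (auto simp: max_def min_def abs_if)
      with g(2)[OF that] q_g[of x] show ?thesis by linarith
    qed
    show "\<bar>q (g x)\<bar> \<le> B + e" for x
    proof -
      have "\<bar>clip (g x)\<bar> \<le> B"
        using \<open>0 \<le> B\<close> unfolding clip_def by (auto simp: max_def min_def)
      with q_g[of x] \<open>0 < e\<close> show ?thesis by linarith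
    qed
  qed
qed

section \<open>Transfer of tightness\<close>

text \<open>The Gaussian is the characteristic function of the standard normal law at \<open>t \<bullet> x\<close>; Fubini
  exchanges the two integrations.\<close>

lemma integral_gaussian_eq_char_fun:
  fixes M :: "'a::euclidean_space measure"
  assumes M: "borel_prob M"
  shows "complex_of_real (LINT x|M. exp (- (t \<bullet> x)\<^sup>2 / 2)) =
    (CLINT r|std_normal_distribution. char_fun M (r *\<^sub>R t))"
proof -
  interpret M: prob_space M using M by (rule borel_prob_imp_prob_space)
  interpret N: real_distribution std_normal_distribution by (rule real_dist_normal_dist)
  interpret P: pair_prob_space std_normal_distribution M ..
  note [measurable_cong] = borel_prob_imp_sets[OF M]
  have "integrable (std_normal_distribution \<Otimes>\<^sub>M M) (\<lambda>(r, x). iexp ((r *\<^sub>R t) \<bullet> x))"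
    by (rule P.P.integrable_const_bound[of _ 1]) auto
  then have "(CLINT r|std_normal_distribution. char_fun M (r *\<^sub>R t)) =
      (CLINT x|M. CLINT r|std_normal_distribution. iexp ((r *\<^sub>R t) \<bullet> x))"
    unfolding char_fun_def by (rule P.Fubini_integral[symmetric])
  also have "\<dots> = (CLINT x|M. char std_normal_distribution (t \<bullet> x))"
    by (simp add: char_def mult.commute)
  also have "\<dots> = complex_of_real (LINT x|M. exp (- (t \<bullet> x)\<^sup>2 / 2))"
    by (simp only: char_std_normal_distribution integral_complex_of_real)
  finally show ?thesis ..
qed

lemma tendsto_integral_gaussian_diff:
  fixes M N :: "nat \<Rightarrow> 'a::euclidean_space measure"
  assumes M: "\<And>n. borel_prob (M n)" and N: "\<And>n. borel_prob (N n)"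
    and char: "\<And>t. (\<lambda>n. char_fun (M n) t - char_fun (N n) t) \<longlonglongrightarrow> 0"
  shows "(\<lambda>n. (LINT x|M n. exp (- (t \<bullet> x)\<^sup>2 / 2)) - (LINT x|N n. exp (- (t \<bullet> x)\<^sup>2 / 2))) \<longlonglongrightarrow> 0"
proof -
  interpret G: real_distribution std_normal_distribution by (rule real_dist_normal_dist)
  have meas: "(\<lambda>r. char_fun L (r *\<^sub>R t)) \<in> borel_measurable std_normal_distribution"
    if L: "borel_prob L" for L :: "'a measure"
  proof -
    interpret L: prob_space L using L by (rule borel_prob_imp_prob_space)
    note [measurable_cong] = borel_prob_imp_sets[OF L]
    show ?thesis unfolding char_fun_def by measurable
  qed
  have int: "integrable std_normal_distribution (\<lambda>r. char_fun L (r *\<^sub>R t))"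
    if L: "borel_prob L" for L :: "'a measure"
    using meas[OF L] cmod_char_fun_le_1[OF L] by (intro G.integrable_const_bound[of _ 1]) auto
  have "(\<lambda>n. CLINT r|std_normal_distribution. char_fun (M n) (r *\<^sub>R t) - char_fun (N n) (r *\<^sub>R t))
      \<longlonglongrightarrow> (CLINT r|std_normal_distribution. 0)"
  proof (rule integral_dominated_convergence[where w = "\<lambda>_. 2"])
    show "AE r in std_normal_distribution.
        cmod (char_fun (M n) (r *\<^sub>R t) - char_fun (N n) (r *\<^sub>R t)) \<le> 2" for n
    proof (intro AE_I2)
      fix r
      show "cmod (char_fun (M n) (r *\<^sub>R t) - char_fun (N n) (r *\<^sub>R t)) \<le> 2"
        using norm_triangle_ineq4[of "char_fun (M n) (r *\<^sub>R t)" "char_fun (N n) (r *\<^sub>R t)"]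
          cmod_char_fun_le_1[OF M, of n "r *\<^sub>R t"] cmod_char_fun_le_1[OF N, of n "r *\<^sub>R t"]
        by linarith
    qed
  qed (use meas M N char in auto)
  then have "(\<lambda>n. complex_of_real
      ((LINT x|M n. exp (- (t \<bullet> x)\<^sup>2 / 2)) - (LINT x|N n. exp (- (t \<bullet> x)\<^sup>2 / 2)))) \<longlonglongrightarrow> of_real 0"
    by (simp only: of_real_diff integral_gaussian_eq_char_fun M N int
        Bochner_Integration.integral_diff integral_zero of_real_0)
  then show ?thesis
    by (simp only: tendsto_of_real_iff)
qed

text \<open>A sum over coordinates, rather than one minus a Gaussian in \<open>norm x\<close>, so that each summand is a
  Gaussian in a single linear form, as in the lemmas above. The parameter \<open>s\<close> is an inverse length:
  the function is negligible where \<open>norm x\<close> is much less than \<open>1 / s\<close> and bounded below beyond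
  \<open>DIM('a) / s\<close>, hence it serves as a smooth substitute for the indicator of a tail.\<close>

definition gaussian_defect :: "real \<Rightarrow> 'a::euclidean_space \<Rightarrow> real" where
  "gaussian_defect s x = (\<Sum>b\<in>Basis. 1 - exp (- ((s *\<^sub>R b) \<bullet> x)\<^sup>2 / 2))"

lemma gaussian_defect_continuous: "continuous_on S (gaussian_defect s)"
  unfolding gaussian_defect_def by (intro continuous_intros) auto

lemma gaussian_defect_nonneg: "0 \<le> gaussian_defect s x"
  unfolding gaussian_defect_def by (intro sum_nonneg) simp

lemma gaussian_defect_le_DIM: "gaussian_defect s (x::'a::euclidean_space) \<le> DIM('a)"
  unfolding gaussian_defect_def
  by (rule order_trans[OF sum_bounded_above[of _ _ 1]]) auto

lemma gaussian_defect_le_square: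
  fixes x :: "'a::euclidean_space"
  shows "gaussian_defect s x \<le> DIM('a) * (s\<^sup>2 * (norm x)\<^sup>2)"
  unfolding gaussian_defect_def
proof (rule order_trans[OF sum_bounded_above[of _ _ "s\<^sup>2 * (norm x)\<^sup>2"]])
  fix b :: 'a assume b: "b \<in> Basis"
  have "1 - exp (- ((s *\<^sub>R b) \<bullet> x)\<^sup>2 / 2) \<le> (s * (b \<bullet> x))\<^sup>2 / 2"
    using exp_ge_add_one_self[of "- ((s *\<^sub>R b) \<bullet> x)\<^sup>2 / 2"] by simp
  also have "\<dots> \<le> s\<^sup>2 * (b \<bullet> x)\<^sup>2"
    by (simp add: power_mult_distrib)
  also have "\<dots> \<le> s\<^sup>2 * (norm x)\<^sup>2"
    using Basis_le_norm[OF b, of x] by (intro mult_left_mono) (simp_all add: inner_commute flip: abs_le_square_iff)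
  finally show "1 - exp (- ((s *\<^sub>R b) \<bullet> x)\<^sup>2 / 2) \<le> s\<^sup>2 * (norm x)\<^sup>2" .
qed simp

text \<open>If the norm is large, then by the triangle inequality some coordinate is at least \<open>1 / s\<close>, and
  that coordinate alone contributes enough.\<close>

lemma gaussian_defect_ge_tail:
  fixes x :: "'a::euclidean_space"
  assumes "0 < s" "DIM('a) / s \<le> norm x"
  shows "1 - exp (- (1/2)) \<le> gaussian_defect s x"
proof -
  have "\<exists>b\<in>Basis. 1 / s \<le> \<bar>x \<bullet> b\<bar>"
  proof (rule ccontr)
    assume "\<not> ?thesis"
    then have "(\<Sum>b\<in>Basis. \<bar>x \<bullet> b\<bar>) < (\<Sum>b\<in>(Basis::'a set). 1 / s)"
      by (intro sum_strict_mono) (auto simp: not_le)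
    with norm_le_l1[of x] assms(2) show False by simp
  qed
  then obtain b where b: "b \<in> Basis" "1 / s \<le> \<bar>x \<bullet> b\<bar>" by blast
  have "1 \<le> \<bar>(s *\<^sub>R b) \<bullet> x\<bar>"
    using b(2) \<open>0 < s\<close> by (simp add: abs_mult inner_commute field_simps)
  then have "1 \<le> ((s *\<^sub>R b) \<bullet> x)\<^sup>2"
    using abs_le_square_iff[of 1 "(s *\<^sub>R b) \<bullet> x"] by simp
  then have "1 - exp (- (1/2)) \<le> 1 - exp (- ((s *\<^sub>R b) \<bullet> x)\<^sup>2 / 2)"
    by simp
  also have "\<dots> \<le> gaussian_defect s x"
    unfolding gaussian_defect_def using b(1) by (intro member_le_sum) auto
  finally show ?thesis .
qed

lemma gaussian_defect_integrable:
  fixes M :: "'a::euclidean_space measure"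
  assumes "borel_prob M"
  shows "integrable M (gaussian_defect s)"
  using assms
  by (rule borel_prob_integrable[of _ _ "DIM('a)"])
    (simp_all add: gaussian_defect_continuous gaussian_defect_nonneg gaussian_defect_le_DIM)

lemma measure_tail_le_gaussian_defect:
  fixes M :: "'a::euclidean_space measure"
  assumes M: "borel_prob M" and "0 < s"
  shows "(1 - exp (- (1/2))) * measure M (- cball 0 (DIM('a) / s)) \<le> (LINT x|M. gaussian_defect s x)"
proof -
  interpret prob_space M using M by (rule borel_prob_imp_prob_space)
  have sets: "- cball 0 (DIM('a) / s) \<in> sets M"
    using borel_prob_imp_sets[OF M] by simp
  have "(1 - exp (- (1/2))) * measure M (- cball 0 (DIM('a) / s)) =
      (LINT x|M. (1 - exp (- (1/2))) * indicator (- cball 0 (DIM('a) / s)) x)"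
    using sets by (simp add: borel_prob_imp_space[OF M])
  also have "\<dots> \<le> (LINT x|M. gaussian_defect s x)"
  proof (rule integral_mono)
    show "(1 - exp (- (1/2))) * indicator (- cball 0 (DIM('a) / s)) x \<le> gaussian_defect s x" for x :: 'a
      using gaussian_defect_ge_tail[OF \<open>0 < s\<close>, of x] gaussian_defect_nonneg[of s x]
      by (auto split: split_indicator)
  qed (use sets gaussian_defect_integrable[OF M] in \<open>auto simp: emeasure_eq_measure integrable_indicator_iff\<close>)
  finally show ?thesis .
qed

lemma integral_gaussian_defect_le:
  fixes M :: "'a::euclidean_space measure" and s R :: real
  assumes M: "borel_prob M"
  shows "(LINT x|M. gaussian_defect s x) \<le> DIM('a) * (s\<^sup>2 * R\<^sup>2) + DIM('a) * measure M (- cball 0 R)"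
proof -
  interpret prob_space M using M by (rule borel_prob_imp_prob_space)
  have sets: "- cball 0 R \<in> sets M"
    using borel_prob_imp_sets[OF M] by simp
  have "(LINT x|M. gaussian_defect s x) \<le>
      (LINT x|M. DIM('a) * (s\<^sup>2 * R\<^sup>2) + DIM('a) * indicat_real (- cball 0 R) x)"
  proof (rule integral_mono)
    fix x :: 'a
    show "gaussian_defect s x \<le> DIM('a) * (s\<^sup>2 * R\<^sup>2) + DIM('a) * indicat_real (- cball 0 R) x"
    proof (cases "norm x \<le> R")
      case True
      then have "DIM('a) * (s\<^sup>2 * (norm x)\<^sup>2) \<le> DIM('a) * (s\<^sup>2 * R\<^sup>2)"
        by (intro mult_left_mono power_mono) auto
      moreover have "indicator (- cball 0 R) x = (0::real)"
        using True by simp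
      ultimately show ?thesis
        using gaussian_defect_le_square[of s x] by (simp only: mult_zero_right)
    next
      case False
      then have "indicator (- cball 0 R) x = (1::real)"
        by simp
      moreover have "0 \<le> DIM('a) * (s\<^sup>2 * R\<^sup>2)" by simp
      ultimately show ?thesis
        using gaussian_defect_le_DIM[of s x] by (simp only: mult_1_right)
    qed
  qed (use sets gaussian_defect_integrable[OF M] in \<open>auto simp: emeasure_eq_measure integrable_indicator_iff\<close>)
  also have "\<dots> = DIM('a) * (s\<^sup>2 * R\<^sup>2) + DIM('a) * measure M (- cball 0 R)"
    using sets prob_space
    by (simp add: borel_prob_imp_space[OF M] emeasure_eq_measure integrable_indicator_iff)
  finally show ?thesis .
qed

lemma tendsto_integral_gaussian_defect_diff:
  fixes M N :: "nat \<Rightarrow> 'a::euclidean_space measure"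
  assumes M: "\<And>n. borel_prob (M n)" and N: "\<And>n. borel_prob (N n)"
    and char: "\<And>t. (\<lambda>n. char_fun (M n) t - char_fun (N n) t) \<longlonglongrightarrow> 0"
  shows "(\<lambda>n. (LINT x|M n. gaussian_defect s x) - (LINT x|N n. gaussian_defect s x)) \<longlonglongrightarrow> 0"
proof -
  have eq: "(LINT x|L. gaussian_defect s x) =
      (\<Sum>b\<in>Basis. 1 - (LINT x|L. exp (- ((s *\<^sub>R b) \<bullet> x)\<^sup>2 / 2)))"
    if L: "borel_prob L" for L :: "'a measure"
  proof -
    interpret prob_space L using L by (rule borel_prob_imp_prob_space)
    have "integrable L (\<lambda>x. exp (- ((s *\<^sub>R b) \<bullet> x)\<^sup>2 / 2))" for b
      by (rule borel_prob_integrable[OF L, of _ 1]) (auto intro!: continuous_intros)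
    then show ?thesis
      unfolding gaussian_defect_def by (simp add: prob_space)
  qed
  have "(\<lambda>n. \<Sum>b\<in>(Basis::'a set). - ((LINT x|M n. exp (- ((s *\<^sub>R b) \<bullet> x)\<^sup>2 / 2)) -
      (LINT x|N n. exp (- ((s *\<^sub>R b) \<bullet> x)\<^sup>2 / 2)))) \<longlonglongrightarrow> (\<Sum>b\<in>(Basis::'a set). - 0)"
    by (intro tendsto_sum tendsto_minus tendsto_integral_gaussian_diff M N char)
  then show ?thesis
    by (simp add: eq M N flip: sum_subtractf)
qed

text \<open>Tightness of \<open>N\<close> passes to \<open>M\<close>: the tail of \<open>M n\<close> is controlled by its Gaussian defect, which is
  close to that of \<open>N n\<close>, which in turn is small once \<open>s\<close> is small compared with a radius \<open>R\<close> that
  captures most of the mass of every \<open>N n\<close>.\<close>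

lemma eventually_tail_le:
  fixes M N :: "nat \<Rightarrow> 'a::euclidean_space measure"
  assumes M: "\<And>n. borel_prob (M n)" and N: "\<And>n. borel_prob (N n)"
    and char: "\<And>t. (\<lambda>n. char_fun (M n) t - char_fun (N n) t) \<longlonglongrightarrow> 0"
    and tight: "\<And>e. 0 < e \<Longrightarrow> \<exists>R. \<forall>n. measure (N n) (- cball 0 R) \<le> e"
    and "0 < e"
  shows "\<exists>R. \<forall>\<^sub>F n in sequentially. measure (M n) (- cball 0 R) \<le> e"
proof -
  define c where "c = 1 - exp (- (1/2) :: real)"
  define d where "d = real DIM('a)"
  have "0 < c" by (simp add: c_def)
  have "0 < d" by (simp add: d_def)
  obtain R where R: "\<And>n. measure (N n) (- cball 0 R) \<le> c * e / (3 * d)"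
    using tight[of "c * e / (3 * d)"] \<open>0 < c\<close> \<open>0 < d\<close> \<open>0 < e\<close> by auto
  \<comment> \<open>The square root makes the bound on the ball of radius \<open>R\<close> at most a third of \<open>c * e\<close>; the
    summand 1 allows \<open>R = 0\<close>.\<close>
  define s where "s = sqrt (c * e / (3 * d * (R\<^sup>2 + 1)))"
  have "0 < s"
    using \<open>0 < c\<close> \<open>0 < d\<close> \<open>0 < e\<close> by (auto simp: s_def intro!: divide_pos_pos mult_pos_pos add_nonneg_pos)
  have "s\<^sup>2 = c * e / (3 * d * (R\<^sup>2 + 1))"
    using \<open>0 < c\<close> \<open>0 < d\<close> \<open>0 < e\<close> by (simp add: s_def)
  then have "d * (s\<^sup>2 * R\<^sup>2) = d * (c * e / (3 * d * (R\<^sup>2 + 1)) * R\<^sup>2)"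
    by (simp only:)
  also have "\<dots> = (c * e / 3) * (R\<^sup>2 / (R\<^sup>2 + 1))"
    using \<open>0 < d\<close> by simp
  also have "\<dots> \<le> (c * e / 3) * 1"
    using \<open>0 < c\<close> \<open>0 < e\<close> by (intro mult_left_mono) (auto simp: divide_le_eq add_nonneg_pos)
  finally have s: "d * (s\<^sup>2 * R\<^sup>2) \<le> c * e / 3" by simp
  have N_le: "(LINT x|N n. gaussian_defect s x) \<le> 2 * (c * e / 3)" for n
  proof -
    have "d * measure (N n) (- cball 0 R) \<le> d * (c * e / (3 * d))"
      using R[of n] \<open>0 < d\<close> by (intro mult_left_mono) auto
    also have "\<dots> = c * e / 3"
      using \<open>0 < d\<close> by simp
    finally show ?thesis
      using integral_gaussian_defect_le[OF N[of n], of s R] s by (simp add: d_def)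
  qed
  have "\<forall>\<^sub>F n in sequentially.
      dist ((LINT x|M n. gaussian_defect s x) - (LINT x|N n. gaussian_defect s x)) 0 < c * e / 3"
    using \<open>0 < c\<close> \<open>0 < e\<close>
    by (intro tendstoD[OF tendsto_integral_gaussian_defect_diff] M N char) simp
  then have "\<forall>\<^sub>F n in sequentially. measure (M n) (- cball 0 (d / s)) \<le> e"
  proof eventually_elim
    case (elim n)
    then have "c * measure (M n) (- cball 0 (d / s)) \<le> c * e"
      using measure_tail_le_gaussian_defect[OF M \<open>0 < s\<close>, of n] N_le[of n]
      unfolding c_def[symmetric] d_def[symmetric] dist_real_def by linarith
    then show ?case using \<open>0 < c\<close> by simp
  qed
  then show ?thesis by blast
qed

section \<open>Weak convergence from characteristic functions\<close>

lemma tendsto_integral_trig_polynomial_diff: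
  fixes M N :: "nat \<Rightarrow> 'a::euclidean_space measure"
  assumes M: "\<And>n. borel_prob (M n)" and N: "\<And>n. borel_prob (N n)"
    and char: "\<And>t. (\<lambda>n. char_fun (M n) t - char_fun (N n) t) \<longlonglongrightarrow> 0"
    and "trig_polynomial h"
  shows "(\<lambda>n. (LINT x|M n. h x) - (LINT x|N n. h x)) \<longlonglongrightarrow> 0"
  using \<open>trig_polynomial h\<close>
proof (induction rule: trig_polynomial.induct)
  case (scale f c)
  then show ?case
    by (auto intro: tendsto_mult_right_zero simp flip: right_diff_distrib)
next
  case (add f g)
  have int: "integrable L h" if "borel_prob L" "trig_polynomial h" for L and h :: "'a \<Rightarrow> real"
    using trig_polynomial_bounded[OF that(2)] borel_prob_integrable[OF that(1)]
      trig_polynomial_continuous[OF that(2)] by (metis real_norm_def)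
  have "(\<lambda>n. ((LINT x|M n. f x) - (LINT x|N n. f x)) + ((LINT x|M n. g x) - (LINT x|N n. g x)))
      \<longlonglongrightarrow> 0 + 0"
    using add.IH by (rule tendsto_add)
  then show ?case
    by (simp add: int M N add.hyps algebra_simps)
qed (use char in \<open>simp_all add: tendsto_char_fun_diff_iff M N\<close>)

lemma integral_diff_le_tail:
  fixes f h :: "'a::topological_space \<Rightarrow> real"
  assumes M: "borel_prob M" and K: "closed K"
    and f: "continuous_on UNIV f" "\<And>x. \<bar>f x\<bar> \<le> B" and h: "continuous_on UNIV h" "\<And>x. \<bar>h x\<bar> \<le> D"
    and close: "\<And>x. x \<in> K \<Longrightarrow> \<bar>f x - h x\<bar> \<le> e" and "0 \<le> e"
  shows "\<bar>(LINT x|M. f x) - (LINT x|M. h x)\<bar> \<le> e + (B + D) * measure M (- K)"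
proof -
  interpret prob_space M using M by (rule borel_prob_imp_prob_space)
  have sets: "- K \<in> sets M"
    using K borel_prob_imp_sets[OF M] by simp
  have int: "integrable M f" "integrable M h"
    using borel_prob_integrable[OF M f(1)] borel_prob_integrable[OF M h(1)] f(2) h(2) by auto
  then have "\<bar>(LINT x|M. f x) - (LINT x|M. h x)\<bar> = \<bar>LINT x|M. f x - h x\<bar>"
    by simp
  also have "\<dots> \<le> (LINT x|M. \<bar>f x - h x\<bar>)"
    by (rule integral_abs_bound)
  also have "\<dots> \<le> (LINT x|M. e + (B + D) * indicator (- K) x)"
  proof (rule integral_mono)
    show "\<bar>f x - h x\<bar> \<le> e + (B + D) * indicator (- K) x" for x
      using close[of x] f(2)[of x] h(2)[of x] \<open>0 \<le> e\<close> by (auto split: split_indicator)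
  qed (use sets int in \<open>auto simp: emeasure_eq_measure integrable_indicator_iff\<close>)
  also have "\<dots> = e + (B + D) * measure M (- K)"
    using sets prob_space
    by (simp add: borel_prob_imp_space[OF M] emeasure_eq_measure integrable_indicator_iff)
  finally show ?thesis .
qed

text \<open>The Levy continuity theorem with a moving target. The case of a constant sequence \<open>N\<close>, for
  which tightness is automatic, is the usual theorem.\<close>

theorem tendsto_integral_diff_of_char_fun:
  fixes M N :: "nat \<Rightarrow> 'a::euclidean_space measure" and f :: "'a \<Rightarrow> real"
  assumes M: "\<And>n. borel_prob (M n)" and N: "\<And>n. borel_prob (N n)"
    and char: "\<And>t. (\<lambda>n. char_fun (M n) t - char_fun (N n) t) \<longlonglongrightarrow> 0"
    and tight: "\<And>e. 0 < e \<Longrightarrow> \<exists>R. \<forall>n. measure (N n) (- cball 0 R) \<le> e"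
    and f: "continuous_on UNIV f" "bounded (range f)"
  shows "(\<lambda>n. (LINT x|M n. f x) - (LINT x|N n. f x)) \<longlonglongrightarrow> 0"
  unfolding tendsto_iff
proof (intro allI impI)
  fix e :: real assume "0 < e"
  obtain B where B: "0 < B" "\<And>x. \<bar>f x\<bar> \<le> B"
    using f(2) by (auto simp: bounded_pos)
  \<comment> \<open>Replacing \<open>f\<close> by \<open>h\<close> will cost \<open>2 * \<epsilon>\<close> for each of the two measures, and comparing the integrals
    of \<open>h\<close> another \<open>\<epsilon>\<close>; \<open>\<delta>\<close> makes the tail contribution, where \<open>\<bar>f - h\<bar> \<le> B + (B + \<epsilon>)\<close>, at most \<open>\<epsilon>\<close>.\<close>
  define \<epsilon> where "\<epsilon> = e / 8"
  define \<delta> where "\<delta> = \<epsilon> / (B + (B + \<epsilon>))"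
  have "0 < \<epsilon>" "0 < \<delta>"
    using \<open>0 < e\<close> \<open>0 < B\<close> by (auto simp: \<epsilon>_def \<delta>_def intro!: divide_pos_pos add_pos_pos)
  obtain R1 where R1: "\<And>n. measure (N n) (- cball 0 R1) \<le> \<delta>"
    using tight[OF \<open>0 < \<delta>\<close>] by blast
  obtain R2 where R2: "\<forall>\<^sub>F n in sequentially. measure (M n) (- cball 0 R2) \<le> \<delta>"
    using eventually_tail_le[OF M N char tight \<open>0 < \<delta>\<close>] by blast
  define K where "K = cball (0::'a) (max R1 R2)"
  have tail: "measure L (- K) \<le> measure L (- cball 0 R)"
    if "R \<le> max R1 R2" and L: "borel_prob L" for R and L :: "'a measure"
  proof -
    interpret prob_space L using L by (rule borel_prob_imp_prob_space)
    show ?thesis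
      using that(1) by (intro finite_measure_mono) (auto simp: K_def borel_prob_imp_sets[OF L])
  qed
  obtain h where h: "trig_polynomial h" "\<And>x. x \<in> K \<Longrightarrow> \<bar>f x - h x\<bar> \<le> \<epsilon>" "\<And>x. \<bar>h x\<bar> \<le> B + \<epsilon>"
    using trig_polynomial_approx[of K f B \<epsilon>] B \<open>0 < \<epsilon>\<close> continuous_on_subset[OF f(1)]
    by (auto simp: K_def)
  have approx: "\<bar>(LINT x|L. f x) - (LINT x|L. h x)\<bar> \<le> 2 * \<epsilon>"
    if L: "borel_prob L" and small: "measure L (- K) \<le> \<delta>" for L
  proof -
    have "\<bar>(LINT x|L. f x) - (LINT x|L. h x)\<bar> \<le> \<epsilon> + (B + (B + \<epsilon>)) * measure L (- K)"
      using h f B \<open>0 < \<epsilon>\<close> trig_polynomial_continuous[OF h(1)]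
      by (intro integral_diff_le_tail L) (auto simp: K_def)
    also have "\<dots> \<le> \<epsilon> + (B + (B + \<epsilon>)) * \<delta>"
      using small B \<open>0 < \<epsilon>\<close> by (intro add_left_mono mult_left_mono) auto
    also have "\<dots> = 2 * \<epsilon>"
      using B \<open>0 < \<epsilon>\<close> by (simp add: \<delta>_def)
    finally show ?thesis .
  qed
  have "\<forall>\<^sub>F n in sequentially. dist ((LINT x|M n. h x) - (LINT x|N n. h x)) 0 < \<epsilon>"
    using tendsto_integral_trig_polynomial_diff[OF M N char h(1)] \<open>0 < \<epsilon>\<close>
    unfolding tendsto_iff by blast
  with R2 show "\<forall>\<^sub>F n in sequentially. dist ((LINT x|M n. f x) - (LINT x|N n. f x)) 0 < e"
  proof eventually_elim
    case (elim n)
    have "\<bar>(LINT x|M n. f x) - (LINT x|M n. h x)\<bar> \<le> 2 * \<epsilon>"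
      using approx[OF M] tail[OF _ M, of R2 n] elim(1) by force
    moreover have "\<bar>(LINT x|N n. f x) - (LINT x|N n. h x)\<bar> \<le> 2 * \<epsilon>"
      using approx[OF N] tail[OF _ N, of R1 n] R1[of n] by force
    ultimately show ?case
      using elim(2) \<open>0 < \<epsilon>\<close> unfolding \<epsilon>_def dist_real_def by linarith
  qed
qed

section \<open>Relative compactness in total variation implies tightness\<close>

lemma measure_diff_le_tv_dist:
  assumes M: "borel_prob M" and N: "borel_prob N" and "C \<in> sets borel"
  shows "\<bar>measure M C - measure N C\<bar> \<le> tv_dist M N"
  unfolding tv_dist_def
proof (rule cSUP_upper)
  interpret M: prob_space M using M by (rule borel_prob_imp_prob_space)
  interpret N: prob_space N using N by (rule borel_prob_imp_prob_space)
  have "\<bar>measure M C - measure N C\<bar> \<le> 1" for C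
    using M.prob_le_1[of C] N.prob_le_1[of C] measure_nonneg[of M C] measure_nonneg[of N C] by linarith
  then show "bdd_above ((\<lambda>C. \<bar>measure M C - measure N C\<bar>) ` sets borel)"
    by (auto intro!: bdd_aboveI)
qed fact

lemma measure_outside_cball_tendsto_0:
  fixes M :: "'a::real_normed_vector measure"
  assumes M: "borel_prob M"
  shows "(\<lambda>m. measure M (- cball 0 (real m))) \<longlonglongrightarrow> 0"
proof -
  interpret prob_space M using M by (rule borel_prob_imp_prob_space)
  have "(\<lambda>m. measure M (- cball 0 (real m))) \<longlonglongrightarrow> measure M (\<Inter>m. - cball 0 (real m))"
    by (rule finite_Lim_measure_decseq) (auto simp: decseq_def borel_prob_imp_sets[OF M])
  moreover have "\<exists>m. x \<in> cball 0 (real m)" for x :: 'a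
    using real_arch_simple[of "norm x"] by simp
  then have "(\<Inter>m. - cball 0 (real m)) = ({}::'a set)"
    by blast
  ultimately show ?thesis by simp
qed

text \<open>Otherwise some sequence in \<open>A\<close> keeps mass at least \<open>e\<close> outside the balls of radius \<open>n\<close>. Along a
  convergent subsequence, each fixed tail then has mass at least \<open>e\<close> under all late members, hence
  under the limit \<open>\<nu>\<close>, which contradicts that \<open>\<nu>\<close> is a finite measure.\<close>

lemma tv_relatively_compact_imp_tight:
  fixes A :: "'a::real_normed_vector measure set"
  assumes compact: "tv_relatively_compact A" and A: "\<And>M. M \<in> A \<Longrightarrow> borel_prob M" and "0 < e"
  shows "\<exists>R. \<forall>M\<in>A. measure M (- cball 0 R) \<le> e"
proof (rule ccontr)
  assume "\<not> ?thesis"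
  then have "\<forall>n. \<exists>M\<in>A. e < measure M (- cball 0 (real n))"
    by (auto simp: not_le)
  then obtain \<xi> where \<xi>: "\<And>n. \<xi> n \<in> A" "\<And>n. e < measure (\<xi> n) (- cball 0 (real n))"
    by metis
  obtain k \<nu> where k: "strict_mono k" and \<nu>: "borel_prob \<nu>"
    and lim: "(\<lambda>j. tv_dist (\<xi> (k j)) \<nu>) \<longlonglongrightarrow> 0"
    using compact \<xi>(1) unfolding tv_relatively_compact_def by blast
  have "e \<le> measure \<nu> (- cball 0 (real m))" for m
  proof -
    have "\<forall>\<^sub>F j in sequentially. e - measure \<nu> (- cball 0 (real m)) \<le> tv_dist (\<xi> (k j)) \<nu>"
      using eventually_ge_at_top[of m]
    proof eventually_elim
      case (elim j)
      interpret prob_space "\<xi> (k j)" using A[OF \<xi>(1)] by (rule borel_prob_imp_prob_space)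
      have "m \<le> k j"
        using elim strict_mono_imp_increasing[OF k, of j] by linarith
      then have "measure (\<xi> (k j)) (- cball 0 (real (k j))) \<le> measure (\<xi> (k j)) (- cball 0 (real m))"
        by (intro finite_measure_mono) (auto simp: borel_prob_imp_sets[OF A[OF \<xi>(1)]])
      moreover have "\<bar>measure (\<xi> (k j)) (- cball 0 (real m)) - measure \<nu> (- cball 0 (real m))\<bar>
          \<le> tv_dist (\<xi> (k j)) \<nu>"
        by (rule measure_diff_le_tv_dist[OF A[OF \<xi>(1)] \<nu>]) auto
      ultimately show ?case
        using \<xi>(2)[of "k j"] by linarith
    qed
    then have "e - measure \<nu> (- cball 0 (real m)) \<le> 0"
      by (intro tendsto_lowerbound[OF lim]) auto
    then show ?thesis by simp
  qed
  then have "e \<le> 0"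
    by (intro tendsto_lowerbound[OF measure_outside_cball_tendsto_0[OF \<nu>]]) auto
  with \<open>0 < e\<close> show False by simp
qed

section \<open>The uniform continuity theorem\<close>

text \<open>The shift to \<open>Suc n\<close> makes every member of the sequence a probability measure, since nothing is
  known about index 0.\<close>

lemma weak_conv_uniformly_iff_choice:
  fixes \<mu>n :: "nat \<Rightarrow> nat \<Rightarrow> 'a::topological_space measure"
  assumes \<mu>n: "\<And>n p. n \<ge> 1 \<Longrightarrow> p \<ge> 1 \<Longrightarrow> borel_prob (\<mu>n n p)"
    and \<mu>: "\<And>p. p \<ge> 1 \<Longrightarrow> borel_prob (\<mu> p)"
  shows "weak_conv_uniformly \<mu>n \<mu> \<longleftrightarrow>
    (\<forall>f :: 'a \<Rightarrow> real. continuous_on UNIV f \<longrightarrow> bounded (range f) \<longrightarrow> (\<forall>q. (\<forall>n. q n \<in> {1..}) \<longrightarrow>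
      (\<lambda>n. (LINT x|\<mu>n (Suc n) (q n). f x) - (LINT x|\<mu> (q n). f x)) \<longlonglongrightarrow> 0))"
proof -
  have "(\<lambda>n. SUP p\<in>{1..}. \<bar>(LINT x|\<mu>n n p. f x) - (LINT x|\<mu> p. f x)\<bar>) \<longlonglongrightarrow> 0 \<longleftrightarrow>
      (\<forall>q. (\<forall>n. q n \<in> {1..}) \<longrightarrow>
        (\<lambda>n. (LINT x|\<mu>n (Suc n) (q n). f x) - (LINT x|\<mu> (q n). f x)) \<longlonglongrightarrow> 0)"
    if f: "continuous_on UNIV f" "bounded (range f)" for f :: "'a \<Rightarrow> real"
  proof -
    obtain B where B: "\<And>x. \<bar>f x\<bar> \<le> B"
      using f(2) by (auto simp: bounded_iff)
    have le: "\<bar>(LINT x|\<mu>n (Suc n) p. f x) - (LINT x|\<mu> p. f x)\<bar> \<le> 2 * B" if "p \<in> {1..}" for n p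
      using abs_integral_le_bound[OF \<mu>n f(1) B, of "Suc n" p] abs_integral_le_bound[OF \<mu> f(1) B, of p]
        that by simp
    have "(\<lambda>n. SUP p\<in>{1..}. \<bar>(LINT x|\<mu>n n p. f x) - (LINT x|\<mu> p. f x)\<bar>) \<longlonglongrightarrow> 0 \<longleftrightarrow>
        (\<lambda>n. SUP p\<in>{1..}. \<bar>(LINT x|\<mu>n (Suc n) p. f x) - (LINT x|\<mu> p. f x)\<bar>) \<longlonglongrightarrow> 0"
      by (rule filterlim_sequentially_Suc[symmetric])
    also have "\<dots> \<longleftrightarrow> (\<forall>q. (\<forall>n. q n \<in> {1..}) \<longrightarrow>
        (\<lambda>n. \<bar>(LINT x|\<mu>n (Suc n) (q n). f x) - (LINT x|\<mu> (q n). f x)\<bar>) \<longlonglongrightarrow> 0)"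
      by (rule tendsto_SUP_zero_iff_choice) (use le in auto)
    finally show ?thesis by (simp only: tendsto_rabs_zero_iff)
  qed
  then show ?thesis
    unfolding weak_conv_uniformly_def by blast
qed

lemma char_fun_uniformly_iff_choice:
  fixes \<mu>n :: "nat \<Rightarrow> nat \<Rightarrow> 'a::euclidean_space measure"
  assumes \<mu>n: "\<And>n p. n \<ge> 1 \<Longrightarrow> p \<ge> 1 \<Longrightarrow> borel_prob (\<mu>n n p)"
    and \<mu>: "\<And>p. p \<ge> 1 \<Longrightarrow> borel_prob (\<mu> p)"
  shows "(\<lambda>n. SUP p\<in>{1..}. cmod (char_fun (\<mu>n n p) t - char_fun (\<mu> p) t)) \<longlonglongrightarrow> 0 \<longleftrightarrow>
    (\<forall>q. (\<forall>n. q n \<in> {1..}) \<longrightarrow>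
      (\<lambda>n. char_fun (\<mu>n (Suc n) (q n)) t - char_fun (\<mu> (q n)) t) \<longlonglongrightarrow> 0)"
proof -
  have le: "cmod (char_fun (\<mu>n (Suc n) p) t - char_fun (\<mu> p) t) \<le> 2" if "p \<in> {1..}" for n p
    using norm_triangle_ineq4[of "char_fun (\<mu>n (Suc n) p) t" "char_fun (\<mu> p) t"]
      cmod_char_fun_le_1[OF \<mu>n, of "Suc n" p t] cmod_char_fun_le_1[OF \<mu>, of p t] that by simp
  have "(\<lambda>n. SUP p\<in>{1..}. cmod (char_fun (\<mu>n n p) t - char_fun (\<mu> p) t)) \<longlonglongrightarrow> 0 \<longleftrightarrow>
      (\<lambda>n. SUP p\<in>{1..}. cmod (char_fun (\<mu>n (Suc n) p) t - char_fun (\<mu> p) t)) \<longlonglongrightarrow> 0"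
    by (rule filterlim_sequentially_Suc[symmetric])
  also have "\<dots> \<longleftrightarrow> (\<forall>q. (\<forall>n. q n \<in> {1..}) \<longrightarrow>
      (\<lambda>n. cmod (char_fun (\<mu>n (Suc n) (q n)) t - char_fun (\<mu> (q n)) t)) \<longlonglongrightarrow> 0)"
    by (rule tendsto_SUP_zero_iff_choice) (use le in auto)
  finally show ?thesis by (simp only: tendsto_norm_zero_iff)
qed

theorem theorem4:
  fixes \<mu>n :: "nat \<Rightarrow> nat \<Rightarrow> (real ^ 'd) measure"
    and \<mu> :: "nat \<Rightarrow> (real ^ 'd) measure"
  assumes "\<And>n p. n \<ge> 1 \<Longrightarrow> p \<ge> 1 \<Longrightarrow> borel_prob (\<mu>n n p)"
    and "\<And>p. p \<ge> 1 \<Longrightarrow> borel_prob (\<mu> p)"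
    and "tv_relatively_compact (\<mu> ` {1..})"
  shows "weak_conv_uniformly \<mu>n \<mu> \<longleftrightarrow>
    (\<forall>t :: real ^ 'd.
      (\<lambda>n. SUP p\<in>{1..}. cmod (char_fun (\<mu>n n p) t - char_fun (\<mu> p) t)) \<longlonglongrightarrow> 0)"
proof -
  have prob: "borel_prob (\<mu>n (Suc n) (q n))" "borel_prob (\<mu> (q n))"
    if "\<forall>n. q n \<in> {1..}" for q n
    using that assms(1,2) by auto
  have tight: "\<exists>R. \<forall>n. measure (\<mu> (q n)) (- cball 0 R) \<le> e" if "\<forall>n. q n \<in> {1..}" "0 < e" for q :: "nat \<Rightarrow> nat" and e
    using tv_relatively_compact_imp_tight[OF assms(3) _ \<open>0 < e\<close>] assms(2) that(1)
    by (metis (no_types, lifting) atLeast_iff imageE imageI)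
  show ?thesis
  proof (simp only: weak_conv_uniformly_iff_choice[of \<mu>n \<mu>] char_fun_uniformly_iff_choice[of \<mu>n \<mu>]
      assms(1,2), intro iffI allI impI)
    fix t :: "real ^ 'd" and q :: "nat \<Rightarrow> nat"
    assume weak: "\<forall>f :: real ^ 'd \<Rightarrow> real. continuous_on UNIV f \<longrightarrow> bounded (range f) \<longrightarrow>
        (\<forall>q. (\<forall>n. q n \<in> {1..}) \<longrightarrow>
          (\<lambda>n. (LINT x|\<mu>n (Suc n) (q n). f x) - (LINT x|\<mu> (q n). f x)) \<longlonglongrightarrow> 0)"
      and q: "\<forall>n. q n \<in> {1..}"
    have "bounded (range (\<lambda>x. cos (t \<bullet> x)))" "bounded (range (\<lambda>x. sin (t \<bullet> x)))"
      by (auto intro!: boundedI[of _ 1])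
    then show "(\<lambda>n. char_fun (\<mu>n (Suc n) (q n)) t - char_fun (\<mu> (q n)) t) \<longlonglongrightarrow> 0"
      using weak[rule_format, of "\<lambda>x. cos (t \<bullet> x)" q] weak[rule_format, of "\<lambda>x. sin (t \<bullet> x)" q] q
      by (simp add: tendsto_char_fun_diff_iff prob continuous_on_cos continuous_on_sin continuous_on_inner)
  next
    fix f :: "real ^ 'd \<Rightarrow> real" and q :: "nat \<Rightarrow> nat"
    assume "\<forall>t. \<forall>q. (\<forall>n. q n \<in> {1..}) \<longrightarrow>
        (\<lambda>n. char_fun (\<mu>n (Suc n) (q n)) t - char_fun (\<mu> (q n)) t) \<longlonglongrightarrow> 0"
      and f: "continuous_on UNIV f" "bounded (range f)" and q: "\<forall>n. q n \<in> {1..}"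
    then show "(\<lambda>n. (LINT x|\<mu>n (Suc n) (q n). f x) - (LINT x|\<mu> (q n). f x)) \<longlonglongrightarrow> 0"
      by (intro tendsto_integral_diff_of_char_fun prob tight) auto
  qed
qed

end
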